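(* Let $S$ be a finite set and let $P = \{p(i,j)\}_{i,j\in S}$ be the transition matrix of a Markov chain on $S$ whose limit (invariant) distribution $\pi$ is strictly positive; that is, $\pi$ is the unique invariant distribution of $P$, and $\pi(i) > 0$ for all $i \in S$. Let $P' = \{p'(i,j)\}_{i,j\in S}$ be a transition matrix of a Markov chain on the same state space $S$, with invariant distribution $\pi'$. Suppose that for some state $s_0 \in S$, \[ p'(i,s_0) \geq p(i,s_0) \quad\text{for all } i \in S, \qquad p'(i,j) \leq p(i,j) \quad\text{for all } i \in S \text{ and all } j \in S \text{ with } j \neq s_0, \] and that $p'(i,s_0) > p(i,s_0)$ for at least one $i \in S$. Then $\pi'(s_0) > \pi(s_0)$.
   Context: A transition matrix on a finite set $S$ is a matrix $P=\{p(i,j)\}_{i,j\in S}$ with $p(i,j) \ge 0$ for all $i,j$ and $\sum_{j\in S} p(i,j) = 1$ for every $i\in S$; $p(i,j)$ is the one-step probability of moving from $i$ to $j$. An invariant distribution of $P$ is a probability vector $\pi = (\pi(i))_{i\in S}$ (nonnegative entries summing to $1$) with $\sum_{i\in S}\pi(i)p(i,j) = \pi(j)$ for all $j\in S$. *)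

theory Defs
  imports Complex_Main
begin

text \<open>
  Matrices and vectors indexed by a finite set \<open>S\<close> are real-valued functions of which only
  the values at indices in \<open>S\<close> are relevant.
\<close>

definition transition_matrix :: "'a set \<Rightarrow> ('a \<Rightarrow> 'a \<Rightarrow> real) \<Rightarrow> bool" where
  "transition_matrix S p \<longleftrightarrow>
     (\<forall>i\<in>S. \<forall>j\<in>S. p i j \<ge> 0) \<and> (\<forall>i\<in>S. (\<Sum>j\<in>S. p i j) = 1)"

definition probability_vector :: "'a set \<Rightarrow> ('a \<Rightarrow> real) \<Rightarrow> bool" where
  "probability_vector S \<mu> \<longleftrightarrow> (\<forall>i\<in>S. \<mu> i \<ge> 0) \<and> (\<Sum>i\<in>S. \<mu> i) = 1"

definition invariant_distribution :: "'a set \<Rightarrow> ('a \<Rightarrow> 'a \<Rightarrow> real) \<Rightarrow> ('a \<Rightarrow> real) \<Rightarrow> bool" where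
  "invariant_distribution S p \<mu> \<longleftrightarrow>
     probability_vector S \<mu> \<and> (\<forall>j\<in>S. (\<Sum>i\<in>S. \<mu> i * p i j) = \<mu> j)"

text \<open>Uniqueness is equality on \<open>S\<close>, since the values outside \<open>S\<close> are arbitrary.\<close>

definition unique_invariant_distribution ::
    "'a set \<Rightarrow> ('a \<Rightarrow> 'a \<Rightarrow> real) \<Rightarrow> ('a \<Rightarrow> real) \<Rightarrow> bool" where
  "unique_invariant_distribution S p \<mu> \<longleftrightarrow>
     invariant_distribution S p \<mu> \<and>
     (\<forall>\<nu>. invariant_distribution S p \<nu> \<longrightarrow> (\<forall>i\<in>S. \<nu> i = \<mu> i))"

end

theory Submission
  imports Defs
begin

text \<open>
  Suppose \<open>\<pi>' s0 \<le> \<pi> s0\<close>, and let \<open>v\<close> be the positive part of \<open>\<pi>' - \<pi>\<close>, which vanishes at \<open>s0\<close>.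
  Off \<open>s0\<close> the entries of \<open>p'\<close> are dominated by those of \<open>p\<close>, so \<open>v \<le> v P\<close>; since \<open>P\<close> preserves
  total mass, \<open>v = v P\<close>. By uniqueness \<open>v\<close> is a multiple of \<open>\<pi>\<close>, and \<open>v s0 = 0 < \<pi> s0\<close>
  forces \<open>v = 0\<close>. Hence \<open>\<pi>' \<le> \<pi>\<close>, so \<open>\<pi>' = \<pi>\<close>, which contradicts the strictly larger flow
  of \<open>p'\<close> into \<open>s0\<close>.
\<close>

lemma sum_transition_matrix_apply:
  assumes "transition_matrix S p"
  shows "(\<Sum>j\<in>S. \<Sum>i\<in>S. v i * p i j) = sum v S"
proof -
  have "(\<Sum>j\<in>S. \<Sum>i\<in>S. v i * p i j) = (\<Sum>i\<in>S. v i * (\<Sum>j\<in>S. p i j))"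
    unfolding sum_distrib_left by (rule sum.swap)
  also have "\<dots> = sum v S"
    using assms by (simp add: transition_matrix_def)
  finally show ?thesis .
qed

text \<open>Rows of \<open>p\<close> sum to 1, so both sides have the same total over
  \<open>S\<close>, and a termwise inequality between finite sums of equal value is an
  equality.\<close>

lemma subinvariant_imp_invariant:
  assumes "finite S" and "transition_matrix S p"
    and "\<And>j. j \<in> S \<Longrightarrow> v j \<le> (\<Sum>i\<in>S. v i * p i j)" and "j \<in> S"
  shows "(\<Sum>i\<in>S. v i * p i j) = v j"
  by (rule sum_mono_inv[OF _ assms(3,4,1), symmetric])
    (simp_all add: sum_transition_matrix_apply[OF assms(2)])

text \<open>If \<open>sum v S\<close> is nonzero, dividing by it gives an invariant distribution,
  which uniqueness identifies with \<open>\<pi>\<close>. If it is zero, nonnegativity makes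
  \<open>v\<close> vanish on \<open>S\<close>.\<close>

lemma nonneg_invariant_eq_scaled:
  assumes "finite S" and "unique_invariant_distribution S p \<pi>"
    and nonneg: "\<And>i. i \<in> S \<Longrightarrow> v i \<ge> 0"
    and inv: "\<And>j. j \<in> S \<Longrightarrow> (\<Sum>i\<in>S. v i * p i j) = v j" and "j \<in> S"
  shows "v j = sum v S * \<pi> j"
proof (cases "sum v S = 0")
  case True
  then show ?thesis
    using assms by (simp add: sum_nonneg_eq_0_iff)
next
  case False
  have "invariant_distribution S p (\<lambda>i. v i / sum v S)"
    using False inv
    by (simp add: invariant_distribution_def probability_vector_def nonneg sum_nonneg
        flip: sum_divide_distrib)
  then have "v j / sum v S = \<pi> j"
    using assms unfolding unique_invariant_distribution_def by blast
  then show ?thesis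
    using False by (simp add: field_simps)
qed

theorem theorem1p1:
  fixes S :: "'a set"
    and p p' :: "'a \<Rightarrow> 'a \<Rightarrow> real"
    and \<pi> \<pi>' :: "'a \<Rightarrow> real"
    and s0 :: 'a
  assumes "finite S"
    and "transition_matrix S p"
    and "unique_invariant_distribution S p \<pi>"
    and "\<forall>i\<in>S. \<pi> i > 0"
    and "transition_matrix S p'"
    and "invariant_distribution S p' \<pi>'"
    and "s0 \<in> S"
    and "\<forall>i\<in>S. p' i s0 \<ge> p i s0"
    and "\<forall>i\<in>S. \<forall>j\<in>S. j \<noteq> s0 \<longrightarrow> p' i j \<le> p i j"
    and "\<exists>i\<in>S. p' i s0 > p i s0"
  shows "\<pi>' s0 > \<pi> s0"
proof (rule ccontr)
  assume "\<not> \<pi>' s0 > \<pi> s0"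
  then have le0: "\<pi>' s0 \<le> \<pi> s0" by simp
  have \<pi>_inv: "(\<Sum>i\<in>S. \<pi> i * p i j) = \<pi> j" if "j \<in> S" for j
    using assms(3) that
    by (simp add: unique_invariant_distribution_def invariant_distribution_def)
  have \<pi>'_inv: "(\<Sum>i\<in>S. \<pi>' i * p' i j) = \<pi>' j" if "j \<in> S" for j
    using assms(6) that by (simp add: invariant_distribution_def)
  have \<pi>'_nonneg: "\<pi>' i \<ge> 0" if "i \<in> S" for i
    using assms(6) that by (simp add: invariant_distribution_def probability_vector_def)
  have p_nonneg: "p i j \<ge> 0" if "i \<in> S" "j \<in> S" for i j
    using assms(2) that by (simp add: transition_matrix_def)
  have sums: "sum \<pi>' S = sum \<pi> S"
    using assms(3,6) by (simp add: unique_invariant_distribution_def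
        invariant_distribution_def probability_vector_def)
  define v where "v i = max 0 (\<pi>' i - \<pi> i)" for i
  have v_nonneg: "v i \<ge> 0" for i
    by (simp add: v_def)
  have v_s0: "v s0 = 0"
    using le0 by (simp add: v_def)
  have v_sub: "v j \<le> (\<Sum>i\<in>S. v i * p i j)" if j: "j \<in> S" for j
  proof -
    have vP_nonneg: "0 \<le> (\<Sum>i\<in>S. v i * p i j)"
      using v_nonneg p_nonneg j by (simp add: sum_nonneg)
    show ?thesis
    proof (cases "j = s0")
      case True
      then show ?thesis using vP_nonneg v_s0 by simp
    next
      case False
      have "\<pi>' j \<le> (\<Sum>i\<in>S. \<pi>' i * p i j)"
        unfolding \<pi>'_inv[OF j, symmetric]
        using assms(9) False j \<pi>'_nonneg by (intro sum_mono mult_left_mono) auto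
      then have "\<pi>' j - \<pi> j \<le> (\<Sum>i\<in>S. (\<pi>' i - \<pi> i) * p i j)"
        by (simp add: \<pi>_inv[OF j] left_diff_distrib sum_subtractf)
      also have "\<dots> \<le> (\<Sum>i\<in>S. v i * p i j)"
        using p_nonneg j by (intro sum_mono mult_right_mono) (auto simp: v_def)
      \<comment> \<open>The sum bounds both arguments of the maximum that defines
        \<open>v j\<close>.\<close>
      finally show ?thesis
        using vP_nonneg by (simp add: v_def)
    qed
  qed
  have v_scaled: "v j = sum v S * \<pi> j" if "j \<in> S" for j
    using nonneg_invariant_eq_scaled[OF assms(1,3) v_nonneg
        subinvariant_imp_invariant[OF assms(1,2) v_sub] that] .
  have "sum v S = 0"
    using v_scaled[OF assms(7)] v_s0 assms(4,7) by auto
  then have le: "\<pi>' j \<le> \<pi> j" if "j \<in> S" for j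
    using v_scaled[OF that] by (simp add: v_def)
  \<comment> \<open>Equal total masses leave no room for a strict inequality at any state.\<close>
  have eq: "\<pi>' j = \<pi> j" if "j \<in> S" for j
    by (rule sum_mono_inv[OF sums le that assms(1)])
  \<comment> \<open>A strict increase of a single entry survives the weighting because
    \<open>\<pi>\<close> is positive at every state.\<close>
  have "(\<Sum>i\<in>S. \<pi> i * p i s0) < (\<Sum>i\<in>S. \<pi> i * p' i s0)"
    using assms(1,4,8,10) by (intro sum_strict_mono_ex1) auto
  also have "\<dots> = \<pi>' s0"
    using \<pi>'_inv[OF assms(7)] by (simp add: eq)
  finally show False
    using \<pi>_inv[OF assms(7)] le0 by simp
qed

end
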